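(* Let $\{f_n\}_{n=0}^{\infty}$ be a non-trivial non-negative log-concave sequence without internal zeros. Then the function $$\mu\mapsto f(\mu,x)=\sum_{n=0}^{\infty}\frac{f_n x^n}{n!\,\Gamma(\mu+n)}$$ is strictly log-concave on $(0,\infty)$ for each fixed $x\ge 0$. Moreover, for all real $\mu,a,b$ with $\mu\ge -1$, $a,b>0$, $\mu+a\ge 0$ and $\mu+b\ge 0$, the function $$\varphi_{a,b,\mu}(x):=f(a+\mu,x)f(b+\mu,x)-f(a+b+\mu,x)f(\mu,x)=\sum_{m=0}^{\infty}\varphi_m x^m$$ has positive power series coefficients, $\varphi_m>0$ for all $m\ge 0$, so that $\varphi_{a,b,\mu}$ is absolutely monotonic and multiplicatively convex on $(0,\infty)$.
   Context: $\Gamma$ is Euler's gamma function and $1/\Gamma$ is regarded as an entire function (equal to $0$ at $0,-1,-2,\ldots$). Power series in $x$ are understood as formal power series as far as coefficients are concerned. A non-negative sequence $\{f_n\}_{n\ge0}$ is log-concave if $f_k^2\ge f_{k-1}f_{k+1}$ for all $k\ge1$; it is non-trivial if it is not identically zero; it has no internal zeros if $f_N=0$ implies $f_{N+i}=0$ for all integers $i\ge 0$. A positive continuous function $F$ on an interval $I$ is strictly log-concave if $F(\mu+h)^2>F(\mu)F(\mu+2h)$ for all $h>0$ and $\mu$ with $[\mu,\mu+2h]\subseteq I$. A function is absolutely monotonic on $(0,\infty)$ if it and all its derivatives are non-negative there. A function $\varphi$ is multiplicatively convex on $(0,\infty)$ if $\varphi(x^{\lambda}y^{1-\lambda})\le\varphi(x)^{\lambda}\varphi(y)^{1-\lambda}$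 for all $x,y>0$ and $\lambda\in[0,1]$.
   Formalization: The claim φ_m > 0 for all m ≥ 0 fails in degenerate cases; it is proved except when f_{⌈m/2⌉} = 0, or m = 0, μ = −1 and a = 1 or b = 1, or m = 1 and a = b = −μ, where φ_m = 0 is proved instead. *)

theory Defs
  imports "HOL-Analysis.Analysis" "HOL-Computational_Algebra.Formal_Power_Series"
begin

definition log_concave_seq :: "(nat \<Rightarrow> real) \<Rightarrow> bool" where
  "log_concave_seq f \<longleftrightarrow> (\<forall>n. 0 \<le> f n) \<and> (\<forall>k\<ge>1. f (k - 1) * f (k + 1) \<le> (f k)\<^sup>2)"

definition nontrivial_seq :: "(nat \<Rightarrow> real) \<Rightarrow> bool" where
  "nontrivial_seq f \<longleftrightarrow> (\<exists>n. f n \<noteq> 0)"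

definition no_internal_zeros :: "(nat \<Rightarrow> real) \<Rightarrow> bool" where
  "no_internal_zeros f \<longleftrightarrow> (\<forall>N. f N = 0 \<longrightarrow> (\<forall>i. f (N + i) = 0))"

definition strictly_log_concave_on :: "real set \<Rightarrow> (real \<Rightarrow> real) \<Rightarrow> bool" where
  "strictly_log_concave_on I F \<longleftrightarrow>
     continuous_on I F \<and> (\<forall>\<mu>\<in>I. 0 < F \<mu>) \<and>
     (\<forall>\<mu> h. 0 < h \<and> {\<mu>..\<mu> + 2 * h} \<subseteq> I \<longrightarrow> F \<mu> * F (\<mu> + 2 * h) < (F (\<mu> + h))\<^sup>2)"

text \<open>The differentiability clause is needed because \<^const>\<open>deriv\<close> is total: it says that all
  derivatives exist on \<open>(0, \<infinity>)\<close>.\<close>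

definition absolutely_monotonic :: "(real \<Rightarrow> real) \<Rightarrow> bool" where
  "absolutely_monotonic F \<longleftrightarrow>
     (\<forall>n. \<forall>x>0. (deriv ^^ n) F field_differentiable at x \<and> 0 \<le> (deriv ^^ n) F x)"

text \<open>Since \<open>0 powr 0 = 0\<close>, at \<open>l = 0\<close> or \<open>l = 1\<close> the inequality below is, for functions having
  zeros in \<open>(0, \<infinity>)\<close>, at least as strong as the one read with \<open>0\<^sup>0 = 1\<close>.\<close>

definition multiplicatively_convex :: "(real \<Rightarrow> real) \<Rightarrow> bool" where
  "multiplicatively_convex F \<longleftrightarrow>
     (\<forall>x>0. \<forall>y>0. \<forall>l\<in>{0..1}.
        F (x powr l * y powr (1 - l)) \<le> F x powr l * F y powr (1 - l))"

text \<open>Here \<^const>\<open>rGamma\<close> is the entire function \<open>1 / \<Gamma>\<close>, with value \<open>0\<close> at \<open>0, -1, -2, \<dots>\<close>.\<close>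

definition rgamma_fps :: "(nat \<Rightarrow> real) \<Rightarrow> real \<Rightarrow> real fps" where
  "rgamma_fps f \<mu> = Abs_fps (\<lambda>n. f n / fact n * rGamma (\<mu> + real n))"

definition rgamma_series :: "(nat \<Rightarrow> real) \<Rightarrow> real \<Rightarrow> real \<Rightarrow> real" where
  "rgamma_series f \<mu> x = (\<Sum>n. f n * x ^ n / fact n * rGamma (\<mu> + real n))"

definition phi :: "(nat \<Rightarrow> real) \<Rightarrow> real \<Rightarrow> real \<Rightarrow> real \<Rightarrow> real \<Rightarrow> real" where
  "phi f a b \<mu> x =
     rgamma_series f (a + \<mu>) x * rgamma_series f (b + \<mu>) x
     - rgamma_series f (a + b + \<mu>) x * rgamma_series f \<mu> x"

definition phi_coeff :: "(nat \<Rightarrow> real) \<Rightarrow> real \<Rightarrow> real \<Rightarrow> real \<Rightarrow> nat \<Rightarrow> real" where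
  "phi_coeff f a b \<mu> m =
     fps_nth (rgamma_fps f (a + \<mu>) * rgamma_fps f (b + \<mu>)
              - rgamma_fps f (a + b + \<mu>) * rgamma_fps f \<mu>) m"

end

(* Grouping the indices k and m - k, the m-th coefficient of phi becomes a sum of the products
   f k * f (m - k), which increase towards the middle index, against binomial weights times
   combinations of four products of two values of 1/Gamma. Towards the middle these combinations change sign at
   most once, from nonpositive to positive, so the sum is bounded below by its value for f = 1
   times a nonnegative constant. For f = 1 the Vandermonde convolution evaluates the sum in
   closed form, and its positivity is the strict log-concavity of 1/Gamma. *)
theory Submission
  imports Defs
begin

section \<open>The reciprocal gamma function: log-concavity, boundedness, Vandermonde
  convolution\<close>

lemma rGamma_real_pos: "(x::real) > 0 \<Longrightarrow> rGamma x > 0"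
  by (simp add: rGamma_inverse_Gamma)

lemma rGamma_real_nonneg: "(x::real) \<ge> 0 \<Longrightarrow> rGamma x \<ge> 0"
  using rGamma_real_pos[of x] by (cases "x = 0") auto

text \<open>For \<open>p > 0\<close>, \<open>Digamma\<close> is strictly increasing, so
  \<open>ln_Gamma (x + b) - ln_Gamma x\<close> strictly increases with \<open>x\<close>;
  exponentiating and inverting gives the claim. At \<open>p = 0\<close> the left side
  vanishes.\<close>

lemma rGamma_mult_strict_less:
  fixes p a b :: real
  assumes "0 \<le> p" "0 < a" "0 < b"
  shows "rGamma (p + a + b) * rGamma p < rGamma (p + a) * rGamma (p + b)"
proof (cases "p = 0")
  case True
  then show ?thesis using assms by (simp add: rGamma_real_pos)
next
  case False
  then have p: "p > 0" using assms by simp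
  define h where "h = (\<lambda>x::real. ln_Gamma (x + b) - ln_Gamma x)"
  have "h p < h (p + a)"
  proof (rule DERIV_pos_imp_increasing[of p "p + a" h])
    fix x assume "p \<le> x" "x \<le> p + a"
    then have "x > 0" using p by simp
    then have "(h has_real_derivative (Digamma (x + b) - Digamma x)) (at x)"
      unfolding h_def using assms by (auto intro!: derivative_eq_intros)
    moreover have "Digamma (x + b) - Digamma x > 0"
      using Digamma_real_strict_mono[of x "x + b"] \<open>x > 0\<close> assms by simp
    ultimately show "\<exists>y. (h has_real_derivative y) (at x) \<and> y > 0" by blast
  qed (use assms in simp)
  then have "exp (ln_Gamma (p + a) + ln_Gamma (p + b)) < exp (ln_Gamma (p + a + b) + ln_Gamma p)"
    by (simp add: h_def add_ac)
  then have "Gamma (p + a) * Gamma (p + b) < Gamma (p + a + b) * Gamma p"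
    using p assms by (simp add: Gamma_real_pos_exp exp_add)
  then show ?thesis
    using p assms
    by (simp add: rGamma_inverse_Gamma flip: inverse_mult_distrib)
qed

text \<open>Compactness bounds \<open>rGamma\<close> on [-1, 2]. Beyond 2 the recurrence divides the
  value at \<open>x - 1\<close> by \<open>x - 1 >= 1\<close>, so the same constant persists.\<close>

lemma rGamma_real_bounded:
  obtains C :: real where "C > 0" "\<And>x. x \<ge> -1 \<Longrightarrow> \<bar>rGamma x\<bar> \<le> C"
proof -
  have "bounded (rGamma ` {-1..2::real})"
    by (intro compact_imp_bounded compact_continuous_image continuous_on_rGamma) auto
  then obtain C where C: "C > 0" "\<And>x::real. x \<in> {-1..2} \<Longrightarrow> \<bar>rGamma x\<bar> \<le> C"
    unfolding bounded_pos by auto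
  have "\<bar>rGamma x\<bar> \<le> C" if "x \<ge> -1" "x \<le> real n + 2" for x n
    using that
  proof (induction n arbitrary: x)
    case 0
    then show ?case using C by auto
  next
    case (Suc n)
    show ?case
    proof (cases "x \<le> 2")
      case True
      then show ?thesis using Suc C by auto
    next
      case False
      have "(x - 1) * rGamma x = rGamma (x - 1)"
        using rGamma_plus1[of "x - 1"] by simp
      then have "(x - 1) * \<bar>rGamma x\<bar> = \<bar>rGamma (x - 1)\<bar>"
        using False by (metis abs_mult abs_of_pos diff_gt_0_iff_gt less_trans not_le one_less_numeral_iff semiring_norm(76))
      moreover have "\<bar>rGamma (x - 1)\<bar> \<le> C" using Suc.IH[of "x - 1"] Suc.prems False by simp
      moreover have "\<bar>rGamma x\<bar> \<le> (x - 1) * \<bar>rGamma x\<bar>"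
        using False by (intro mult_le_cancel_right1[THEN iffD2]) auto
      ultimately show ?thesis by linarith
    qed
  qed
  moreover have "x \<le> real (nat \<lceil>x\<rceil>) + 2" for x :: real by linarith
  ultimately show ?thesis using that C by blast
qed

text \<open>Factoring out the two rightmost values of \<open>rGamma\<close> leaves rising factorials
  whose bases depend on \<open>k\<close>. Reflecting them to the bases \<open>- A\<close> and
  \<open>- B\<close> removes that dependence, and the Chu-Vandermonde identity applies.\<close>

lemma rGamma_Vandermonde:
  fixes \<alpha> \<beta> :: real
  shows "(\<Sum>k\<le>m. of_nat (m choose k) * (rGamma (\<alpha> + of_nat k) * rGamma (\<beta> + of_nat (m - k))))
    = pochhammer (\<alpha> + \<beta> + of_nat m - 1) m * (rGamma (\<alpha> + of_nat m) * rGamma (\<beta> + of_nat m))"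
proof -
  define A where "A = \<alpha> + real m - 1"
  define B where "B = \<beta> + real m - 1"
  have "real (m choose k) * (rGamma (\<alpha> + real k) * rGamma (\<beta> + real (m - k)))
      = (-1) ^ m * (real (m choose k) * pochhammer (- B) k * pochhammer (- A) (m - k))
        * (rGamma (\<alpha> + real m) * rGamma (\<beta> + real m))" if "k \<le> m" for k
  proof -
    have "rGamma (\<alpha> + real k) = pochhammer (\<alpha> + real k) (m - k) * rGamma (\<alpha> + real m)"
      using pochhammer_rGamma[of "\<alpha> + real k" "m - k"] that by (simp add: of_nat_diff)
    moreover have "rGamma (\<beta> + real (m - k)) = pochhammer (\<beta> + real (m - k)) k * rGamma (\<beta> + real m)"
      using pochhammer_rGamma[of "\<beta> + real (m - k)" k] that by (simp add: of_nat_diff)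
    moreover have "pochhammer (- A) (m - k) = (-1) ^ (m - k) * pochhammer (\<alpha> + real k) (m - k)"
      unfolding pochhammer_minus A_def using that by (simp add: of_nat_diff algebra_simps)
    moreover have "pochhammer (- B) k = (-1) ^ k * pochhammer (\<beta> + real (m - k)) k"
      unfolding pochhammer_minus B_def using that by (simp add: of_nat_diff algebra_simps)
    moreover have "(-1) ^ m * ((-1) ^ k * (-1) ^ (m - k)) = (1::real)"
      using that by (simp flip: power_add)
    ultimately show ?thesis by simp
  qed
  then have "(\<Sum>k\<le>m. of_nat (m choose k) * (rGamma (\<alpha> + of_nat k) * rGamma (\<beta> + of_nat (m - k))))
    = (\<Sum>k\<le>m. (-1) ^ m * (real (m choose k) * pochhammer (- B) k * pochhammer (- A) (m - k))
        * (rGamma (\<alpha> + real m) * rGamma (\<beta> + real m)))"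
    by (intro sum.cong) auto
  also have "\<dots> = (-1) ^ m * pochhammer (- B + - A) m * (rGamma (\<alpha> + real m) * rGamma (\<beta> + real m))"
    unfolding pochhammer_binomial_sum by (simp add: sum_distrib_left sum_distrib_right)
  also have "- B + - A = - (A + B)" by simp
  also have "(-1) ^ m * pochhammer (- (A + B)) m = pochhammer (\<alpha> + \<beta> + of_nat m - 1) m"
    unfolding pochhammer_minus by (simp add: A_def B_def algebra_simps flip: power_mult_distrib power_add)
  finally show ?thesis .
qed

section \<open>Symmetric sums with weights growing towards the middle\<close>

text \<open>With \<open>K\<close> the first index where \<open>D\<close> is positive, \<open>g k * D k \<ge> g K * D k\<close> for every
  \<open>k\<close>.\<close>

lemma symmetric_weighted_sum_pos:
  fixes g D :: "nat \<Rightarrow> real"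
  assumes gsym: "\<And>k. k \<le> m \<Longrightarrow> g (m - k) = g k"
    and Dsym: "\<And>k. k \<le> m \<Longrightarrow> D (m - k) = D k"
    and g0: "\<And>k. g k \<ge> 0"
    and gmono: "\<And>i j. i \<le> j \<Longrightarrow> j \<le> m div 2 \<Longrightarrow> g i \<le> g j"
    and gmid: "g (m div 2) > 0"
    and step: "\<And>k. 0 < k \<Longrightarrow> k \<le> m div 2 \<Longrightarrow> D k \<le> 0 \<Longrightarrow> D (k - 1) \<le> 0"
    and pos: "(\<Sum>k\<le>m. D k) > 0"
  shows "(\<Sum>k\<le>m. g k * D k) > 0"
proof -
  have half: "P k" if "k \<le> m" "\<And>k. k \<le> m div 2 \<Longrightarrow> P k" "\<And>k. k \<le> m \<Longrightarrow> P (m - k) = P k" for P k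
  proof (cases "k \<le> m div 2")
    case False
    then have "P (m - k)" by (intro that(2)) simp
    then show ?thesis using that by blast
  qed (use that in blast)
  have down: "D i \<le> 0" if "i \<le> j" "j \<le> m div 2" "D j \<le> 0" for i j
    using that
  proof (induction j)
    case (Suc j)
    then show ?case using step[of "Suc j"] by (cases "i = Suc j") auto
  qed simp
  have mid: "D (m div 2) > 0"
  proof (rule ccontr)
    assume "\<not> ?thesis"
    then have "D k \<le> 0" if "k \<le> m div 2" for k
      using down[OF that] by simp
    then have "D k \<le> 0" if "k \<le> m" for k
      using half[OF that, of "\<lambda>k. D k \<le> 0"] Dsym by simp
    then have "(\<Sum>k\<le>m. D k) \<le> 0" by (intro sum_nonpos) auto
    then show False using pos by simp
  qed
  define K where "K = (LEAST k. D k > 0)"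
  have K: "D K > 0" "K \<le> m div 2"
    unfolding K_def using LeastI[of "\<lambda>k. D k > 0", OF mid] Least_le[of "\<lambda>k. D k > 0", OF mid]
    by blast+
  have Kmin: "D i \<le> 0" if "i < K" for i
    using not_less_Least[OF that[unfolded K_def]] by (simp add: not_less)
  have above: "D i > 0" if "K \<le> i" "i \<le> m div 2" for i
    using down[of K i] that K by fastforce
  have ge: "g k * D k \<ge> g K * D k" if "k \<le> m" for k
  proof (rule half[OF that, of "\<lambda>k. g k * D k \<ge> g K * D k"])
    fix i assume i: "i \<le> m div 2"
    show "g K * D i \<le> g i * D i"
    proof (cases "i < K")
      case True
      then show ?thesis using gmono[of i K] K Kmin[of i] by (simp add: mult_right_mono_neg)
    next
      case False
      then show ?thesis using gmono[of K i] i above[of i] by (simp add: mult_right_mono)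
    qed
  qed (simp add: gsym Dsym)
  show ?thesis
  proof (cases "g K = 0")
    case False
    then have "0 < g K * (\<Sum>k\<le>m. D k)" using pos g0[of K] by simp
    also have "\<dots> \<le> (\<Sum>k\<le>m. g k * D k)"
      unfolding sum_distrib_left using ge by (intro sum_mono) auto
    finally show ?thesis .
  next
    \<comment> \<open>The comparison with \<open>g K\<close> times the sum of \<open>D\<close> now
      gives only nonnegative terms; strictness comes from the middle term.\<close>
    case True
    then have "g k * D k \<ge> 0" if "k \<le> m" for k using ge[OF that] by simp
    then show ?thesis using mid gmid by (intro sum_pos2[of _ "m div 2"]) auto
  qed
qed

section \<open>Sign pattern of the cross terms\<close>

text \<open>A weak majorization inequality: by symmetry \<open>rv <= ru\<close>, and then summation
  by parts writes the difference as four nonnegative products. No sign is imposed on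
  \<open>rz\<close>, which in the application is negative for \<open>p < 0\<close>.\<close>

lemma spread_combination_le:
  fixes u v w z ru rv rw rz :: real
  assumes "u \<le> w" "v \<le> w" "0 \<le> z" "z \<le> w" "u + v \<le> w + z"
    and "0 \<le> ru" "0 \<le> rv" "ru \<le> rw" "rv \<le> rw" "ru + rv \<le> rw + rz"
  shows "ru * u + rv * v \<le> rw * w + rz * z"
proof -
  have *: "ru * u + rv * v \<le> rw * w + rz * z"
    if "u \<le> w" "u + v \<le> w + z" "0 \<le> rv" "rv \<le> ru" "ru \<le> rw" "ru + rv \<le> rw + rz"
    for u v ru rv :: real
  proof -
    have "rw * w + rz * z - (ru * u + rv * v) =
      (w - u) * (ru - rv) + (w + z - (u + v)) * rv + (w - z) * (rw - ru) + z * (rw + rz - (ru + rv))"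
      by (simp add: algebra_simps)
    also have "\<dots> \<ge> 0"
      using that assms by (intro add_nonneg_nonneg mult_nonneg_nonneg) auto
    finally show ?thesis by simp
  qed
  show ?thesis
  proof (cases "rv \<le> ru")
    case True
    then show ?thesis using *[of u v rv ru] assms by simp
  next
    case False
    then show ?thesis using *[of v u ru rv] assms by (simp add: add.commute)
  qed
qed

text \<open>The symmetrization in \<open>p\<close> and \<open>q\<close> of one term of the Cauchy
  product difference; it is used with \<open>p = \<mu> + k\<close> and
  \<open>q = \<mu> + (m - k)\<close>.\<close>

definition rGamma_cross :: "real \<Rightarrow> real \<Rightarrow> real \<Rightarrow> real \<Rightarrow> real" where
  "rGamma_cross a b p q = rGamma (p + a) * rGamma (q + b) + rGamma (q + a) * rGamma (p + b)
     - rGamma (p + (a + b)) * rGamma q - rGamma (q + (a + b)) * rGamma p"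

text \<open>Write the cross term as \<open>u + v - w - z\<close>. Log-concavity gives \<open>u * v > w * z\<close> and
  \<open>w > z\<close>, so \<open>u + v \<le> w + z\<close> forces \<open>u, v \<le> w\<close>. Passing from \<open>(p + 1, q)\<close> to
  \<open>(p, q + 1)\<close> multiplies the four products by values of the convex function
  \<open>t \<mapsto> (p + t) / (q + a + b - t)\<close> at \<open>a\<close>, \<open>b\<close>, \<open>a + b\<close> and \<open>0\<close>.\<close>

lemma rGamma_cross_nonpos_step:
  fixes a b p q :: real
  assumes ab: "0 < a" "0 < b" and p: "-1 \<le> p" "0 \<le> p + a" "0 \<le> p + b" and q: "p + 1 \<le> q"
    and le: "rGamma_cross a b (p + 1) q \<le> 0"
  shows "rGamma_cross a b p (q + 1) \<le> 0"
proof -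
  define u where "u = rGamma (p + 1 + a) * rGamma (q + b)"
  define v where "v = rGamma (q + a) * rGamma (p + 1 + b)"
  define w where "w = rGamma (p + 1 + (a + b)) * rGamma q"
  define z where "z = rGamma (q + (a + b)) * rGamma (p + 1)"
  have sum_le: "u + v \<le> w + z"
    using le by (simp add: rGamma_cross_def u_def v_def w_def z_def)
  have lcp: "rGamma (p + 1 + (a + b)) * rGamma (p + 1) < rGamma (p + 1 + a) * rGamma (p + 1 + b)"
    using rGamma_mult_strict_less[of "p + 1" a b] p ab by (simp add: add_ac)
  have lcq: "rGamma (q + (a + b)) * rGamma q < rGamma (q + a) * rGamma (q + b)"
    using rGamma_mult_strict_less[of q a b] p q ab by (simp add: add_ac)
  \<comment> \<open>On the diagonal the cross term is twice the log-concavity gap, hence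
    positive.\<close>
  have "q \<noteq> p + 1"
  proof
    assume "q = p + 1"
    then have "rGamma_cross a b (p + 1) q > 0"
      using lcp by (simp add: rGamma_cross_def mult.commute)
    then show False using le by simp
  qed
  then have pq: "p + 1 < q" using q by simp
  have q0: "0 < q" using pq p by simp
  have nn: "u > 0" "v > 0" "w \<ge> 0" "z \<ge> 0"
    unfolding u_def v_def w_def z_def using p q0 ab
    by (auto intro!: mult_pos_pos mult_nonneg_nonneg rGamma_real_pos rGamma_real_nonneg)
  have prod: "w * z < u * v"
  proof -
    have "(rGamma (p + 1 + (a + b)) * rGamma (p + 1)) * (rGamma (q + (a + b)) * rGamma q)
       < (rGamma (p + 1 + a) * rGamma (p + 1 + b)) * (rGamma (q + a) * rGamma (q + b))"
      using p q0 ab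
      by (intro mult_strict_mono' lcp lcq mult_nonneg_nonneg rGamma_real_nonneg) auto
    then show ?thesis by (simp add: u_def v_def w_def z_def mult_ac)
  qed
  have zw: "z \<le> w"
    using rGamma_mult_strict_less[of "p + 1" "a + b" "q - (p + 1)"] p pq ab
    by (simp add: z_def w_def add_ac)
  \<comment> \<open>If \<open>x > w >= z\<close>, then \<open>x\<close> lies beyond both roots of
    \<open>(t - w) * (t - z)\<close>, so \<open>x * (w + z - x) <= w * z\<close>, which contradicts
    \<open>w * z < x * y\<close>.\<close>
  have dominated: "x \<le> w" if xy: "x + y \<le> w + z" "w * z < x * y" "0 < x" for x y
  proof (rule ccontr)
    assume "\<not> x \<le> w"
    then have "0 \<le> (x - w) * (x - z)" using zw by simp
    moreover have "x * y \<le> x * (w + z - x)" using xy by (intro mult_left_mono) auto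
    ultimately show False using xy by (simp add: algebra_simps)
  qed
  have uw: "u \<le> w" using dominated[of u v] sum_le prod nn by blast
  have vw: "v \<le> w" using dominated[of v u] sum_le prod nn by (simp add: add.commute mult.commute)
  define ru where "ru = (p + a) / (q + b)"
  define rv where "rv = (p + b) / (q + a)"
  define rw where "rw = (p + (a + b)) / q"
  define rz where "rz = p / (q + (a + b))"
  \<comment> \<open>Only \<open>y + t\<close> is divided by. The recurrence of \<open>rGamma\<close>
    holds at every real argument, so a zero or negative \<open>x + s\<close> is harmless.\<close>
  have shift: "rGamma (x + s) * rGamma (y + 1 + t) = (x + s) / (y + t) * (rGamma (x + 1 + s) * rGamma (y + t))"
    if "y + t > 0" for x y s t :: real
  proof -
    have "rGamma (x + s) = (x + s) * rGamma (x + 1 + s)" using rGamma_plus1[of "x + s"] by (simp add: add_ac)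
    moreover have "rGamma (y + t) = (y + t) * rGamma (y + 1 + t)" using rGamma_plus1[of "y + t"] by (simp add: add_ac)
    ultimately show ?thesis using that by simp
  qed
  have "ru * u + rv * v \<le> rw * w + rz * z"
  proof (rule spread_combination_le[OF uw vw nn(4) zw sum_le])
    show "0 \<le> ru" "0 \<le> rv" unfolding ru_def rv_def using p ab q0 by auto
    show "ru \<le> rw" "rv \<le> rw" unfolding ru_def rv_def rw_def using p ab q0 by (auto intro!: frac_le)
    \<comment> \<open>Adding 1 gives all four ratios the numerator \<open>T\<close>. What remains is
      \<open>1/(q + a) + 1/(q + b) <= 1/q + 1/(q + a + b)\<close>, which follows from
      \<open>q * (q + (a + b)) <= (q + a) * (q + b)\<close>.\<close>
    define T where "T = p + q + (a + b)"
    have T: "T \<ge> 0" unfolding T_def using p q0 ab by simp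
    have frac: "(p + s) / (q + t) + 1 = T / (q + t)" if "s + t = a + b" "0 < q + t" for s t
      using that by (simp add: T_def field_simps)
    have "ru + rv + 2 = T / (q + b) + T / (q + a)"
      using frac[of a b] frac[of b a] q0 ab by (simp add: ru_def rv_def)
    also have "\<dots> = T * (2 * q + (a + b)) / ((q + a) * (q + b))"
      using q0 ab by (simp add: field_simps)
    also have "\<dots> \<le> T * (2 * q + (a + b)) / (q * (q + (a + b)))"
      using q0 ab T by (intro frac_le mult_pos_pos) (auto simp: algebra_simps)
    also have "\<dots> = T / q + T / (q + (a + b))"
      using q0 ab by (simp add: field_simps)
    also have "\<dots> = rw + rz + 2"
      using frac[of "a + b" 0] frac[of 0 "a + b"] q0 ab by (simp add: rw_def rz_def)
    finally show "ru + rv \<le> rw + rz" by simp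
  qed
  moreover have "rGamma (p + a) * rGamma (q + 1 + b) = ru * u"
    unfolding ru_def u_def using q0 ab by (intro shift) simp
  moreover have "rGamma (q + 1 + a) * rGamma (p + b) = rv * v"
    unfolding rv_def v_def using shift[of q a p b] q0 ab by (simp add: mult.commute)
  moreover have "rGamma (p + (a + b)) * rGamma (q + 1) = rw * w"
    unfolding rw_def w_def using shift[of q 0 p "a + b"] q0 by simp
  moreover have "rGamma (q + 1 + (a + b)) * rGamma p = rz * z"
    unfolding rz_def z_def using shift[of q "a + b" p 0] q0 ab by (simp add: mult.commute)
  ultimately show ?thesis unfolding rGamma_cross_def by linarith
qed

text \<open>Extends the strict inequality to negative \<open>\<mu>\<close>. Between -1 and 0,
  \<open>rGamma \<mu>\<close> is negative and the right side is not. At -1 the left side is 0, and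
  the right side is positive once \<open>a\<close> and \<open>b\<close> exceed 1.\<close>

lemma rGamma_bracket_pos:
  fixes \<mu> a b :: real
  assumes "-1 \<le> \<mu>" "0 < a" "0 < b" "0 \<le> \<mu> + a" "0 \<le> \<mu> + b" and "\<not> (\<mu> = -1 \<and> (a = 1 \<or> b = 1))"
  shows "rGamma (\<mu> + (a + b)) * rGamma \<mu> < rGamma (\<mu> + a) * rGamma (\<mu> + b)"
proof (cases "0 \<le> \<mu>")
  case True
  then show ?thesis using rGamma_mult_strict_less[of \<mu> a b] assms by (simp add: add_ac)
next
  case False
  have rec: "rGamma \<mu> = \<mu> * rGamma (\<mu> + 1)" by (simp add: rGamma_plus1)
  show ?thesis
  proof (cases "\<mu> = -1")
    case True
    then have "a > 1" "b > 1" using assms by auto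
    then show ?thesis using True rec by (simp add: rGamma_real_pos)
  next
    case ne: False
    then have "rGamma \<mu> < 0" using assms False rec by (simp add: mult_neg_pos rGamma_real_pos)
    moreover have "rGamma (\<mu> + (a + b)) > 0" using assms by (intro rGamma_real_pos) simp
    ultimately have "rGamma (\<mu> + (a + b)) * rGamma \<mu> < 0" by (simp add: mult_pos_neg)
    also have "0 \<le> rGamma (\<mu> + a) * rGamma (\<mu> + b)"
      using assms by (intro mult_nonneg_nonneg rGamma_real_nonneg) auto
    finally show ?thesis .
  qed
qed

section \<open>Products of terms of a log-concave sequence\<close>

text \<open>Monotonicity of the ratios \<open>f (Suc n) / f n\<close>, cleared of denominators. The
  induction cancels \<open>f (Suc (i + d))\<close>; if that is 0, the absence of internal zeros
  makes the left side 0.\<close>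

lemma log_concave_mult_le:
  assumes "log_concave_seq f" "no_internal_zeros f"
  shows "f i * f (Suc (i + d)) \<le> f (Suc i) * f (i + d)"
proof (induction d)
  case (Suc d)
  have nn: "\<And>n. f n \<ge> 0" and lc: "\<And>k. k \<ge> 1 \<Longrightarrow> f (k - 1) * f (k + 1) \<le> (f k)\<^sup>2"
    using assms by (auto simp: log_concave_seq_def)
  show ?case
  proof (cases "f (Suc (i + d)) = 0")
    case True
    then have "f (Suc (Suc (i + d))) = 0"
      using assms(2) unfolding no_internal_zeros_def by (metis add.commute plus_1_eq_Suc)
    then show ?thesis using nn by simp
  next
    case False
    then have pos: "f (Suc (i + d)) > 0" using nn[of "Suc (i + d)"] by simp
    have "f i * f (Suc (Suc (i + d))) * f (Suc (i + d)) \<le> f (Suc i) * (f (i + d) * f (Suc (Suc (i + d))))"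
      using mult_right_mono[OF Suc.IH nn[of "Suc (Suc (i + d))"]] by (simp add: mult_ac)
    also have "\<dots> \<le> f (Suc i) * (f (Suc (i + d)))\<^sup>2"
      using lc[of "Suc (i + d)"] nn by (intro mult_left_mono) auto
    finally have "f i * f (Suc (Suc (i + d))) \<le> f (Suc i) * f (Suc (i + d))"
      using pos by (simp add: power2_eq_square flip: mult.assoc)
    then show ?thesis by simp
  qed
qed simp

lemma log_concave_mult_mono:
  assumes "log_concave_seq f" "no_internal_zeros f" and "i \<le> j" "j \<le> m div 2"
  shows "f i * f (m - i) \<le> f j * f (m - j)"
  using assms(3,4)
proof (induction j)
  case (Suc j)
  show ?case
  proof (cases "i = Suc j")
    case False
    then have "f i * f (m - i) \<le> f j * f (m - j)" using Suc by auto
    \<comment> \<open>Since \<open>Suc j <= m div 2\<close>, the subtraction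
      \<open>m - Suc j - j\<close> is not truncated; it is the gap \<open>d\<close> of
      \<open>log_concave_mult_le\<close>.\<close>
    also have "m - j = Suc (j + (m - Suc j - j))" using Suc.prems by simp
    also have "f j * f (Suc (j + (m - Suc j - j))) \<le> f (Suc j) * f (j + (m - Suc j - j))"
      by (rule log_concave_mult_le[OF assms(1,2)])
    also have "j + (m - Suc j - j) = m - Suc j" using Suc.prems by simp
    finally show ?thesis .
  qed simp
qed simp

lemma no_internal_zeros_mono: "no_internal_zeros f \<Longrightarrow> f i = 0 \<Longrightarrow> i \<le> j \<Longrightarrow> f j = 0"
  unfolding no_internal_zeros_def using le_Suc_ex by blast

section \<open>The coefficients of \<open>phi\<close> and their signs\<close>

lemma sum_symmetrize:
  fixes h :: "nat \<Rightarrow> real"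
  shows "(\<Sum>k\<le>m. h k + h (m - k)) = 2 * (\<Sum>k\<le>m. h k)"
proof -
  have "(\<Sum>k\<le>m. h (m - k)) = (\<Sum>k\<le>m. h k)"
    by (rule sum.reindex_bij_witness[of _ "\<lambda>k. m - k" "\<lambda>k. m - k"]) auto
  then show ?thesis by (simp add: sum.distrib)
qed

text \<open>The factor \<open>fact m\<close> turns the two factorials into a binomial coefficient;
  the factor 2 comes from adding the sum to its reversal.\<close>

lemma phi_coeff_eq_sum_cross:
  "2 * fact m * phi_coeff f a b \<mu> m =
    (\<Sum>k\<le>m. f k * f (m - k) * (real (m choose k) * rGamma_cross a b (\<mu> + real k) (\<mu> + real (m - k))))"
proof -
  define c where "c = (\<lambda>k. rGamma (\<mu> + real k + a) * rGamma (\<mu> + real (m - k) + b)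
     - rGamma (\<mu> + real k + (a + b)) * rGamma (\<mu> + real (m - k)))"
  define h where "h = (\<lambda>k. f k * f (m - k) * (real (m choose k) * c k))"
  have "fact m * phi_coeff f a b \<mu> m = (\<Sum>k\<le>m. h k)"
    unfolding phi_coeff_def fps_sub_nth fps_mult_nth atLeast0AtMost sum_subtractf[symmetric] sum_distrib_left
    by (intro sum.cong)
       (auto simp: rgamma_fps_def h_def c_def binomial_fact field_simps add_ac)
  moreover have "h k + h (m - k) = f k * f (m - k) *
      (real (m choose k) * rGamma_cross a b (\<mu> + real k) (\<mu> + real (m - k)))" if "k \<le> m" for k
    using that binomial_symmetric[OF that] unfolding h_def c_def rGamma_cross_def
    by (simp add: algebra_simps)
  ultimately show ?thesis
    using sum_symmetrize[of h m] by simp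
qed

text \<open>In all four products the two parameters add up to \<open>a + b + 2 * \<mu>\<close>, so
  the Vandermonde convolutions share one Pochhammer factor.\<close>

lemma sum_rGamma_cross:
  "(\<Sum>k\<le>m. real (m choose k) * rGamma_cross a b (\<mu> + real k) (\<mu> + real (m - k))) =
    2 * (pochhammer (a + b + 2 * \<mu> + real m - 1) m *
      (rGamma (\<mu> + real m + a) * rGamma (\<mu> + real m + b)
       - rGamma (\<mu> + real m + (a + b)) * rGamma (\<mu> + real m)))"
proof -
  have "real (m choose k) * rGamma_cross a b (\<mu> + real k) (\<mu> + real (m - k)) =
      (real (m choose k) * (rGamma (\<mu> + a + real k) * rGamma (\<mu> + b + real (m - k)))
       + real (m choose k) * (rGamma (\<mu> + b + real k) * rGamma (\<mu> + a + real (m - k))))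
       - (real (m choose k) * (rGamma (\<mu> + (a + b) + real k) * rGamma (\<mu> + real (m - k)))
       + real (m choose k) * (rGamma (\<mu> + real k) * rGamma (\<mu> + (a + b) + real (m - k))))" for k
    unfolding rGamma_cross_def by (simp add: algebra_simps)
  then show ?thesis
    by (simp only: sum_subtractf sum.distrib rGamma_Vandermonde) (simp add: algebra_simps)
qed

text \<open>For constant \<open>f = 1\<close> the sum is \<open>2 * (P * B)\<close>, and the second
  and third exceptions are where \<open>B\<close> or \<open>P\<close> vanishes. The index
  \<open>(m + 1) div 2\<close> is the upper middle one: \<open>f\<close> is nonzero there exactly
  when the middle product \<open>g (m div 2)\<close> is positive.\<close>

lemma phi_coeff_cases:
  assumes lc: "log_concave_seq f" and niz: "no_internal_zeros f"
    and \<mu>: "-1 \<le> \<mu>" and ab: "0 < a" "0 < b" and \<mu>ab: "0 \<le> \<mu> + a" "0 \<le> \<mu> + b"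
  shows "if f ((m + 1) div 2) = 0
            \<or> (m = 0 \<and> \<mu> = -1 \<and> (a = 1 \<or> b = 1))
            \<or> (m = 1 \<and> a = -\<mu> \<and> b = -\<mu>)
          then phi_coeff f a b \<mu> m = 0
          else phi_coeff f a b \<mu> m > 0"
proof -
  define g where "g = (\<lambda>k. f k * f (m - k))"
  define D where "D = (\<lambda>k. real (m choose k) * rGamma_cross a b (\<mu> + real k) (\<mu> + real (m - k)))"
  define P where "P = pochhammer (a + b + 2 * \<mu> + real m - 1) m"
  define B where "B = rGamma (\<mu> + real m + a) * rGamma (\<mu> + real m + b)
       - rGamma (\<mu> + real m + (a + b)) * rGamma (\<mu> + real m)"
  have f0: "\<And>k. f k \<ge> 0" using lc by (simp add: log_concave_seq_def)
  have coeff: "2 * fact m * phi_coeff f a b \<mu> m = (\<Sum>k\<le>m. g k * D k)"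
    unfolding phi_coeff_eq_sum_cross g_def D_def by simp
  have sumD: "(\<Sum>k\<le>m. D k) = 2 * (P * B)"
    unfolding D_def P_def B_def by (rule sum_rGamma_cross)
  have B_pos: "B > 0" if "\<not> (m = 0 \<and> \<mu> = -1 \<and> (a = 1 \<or> b = 1))"
    unfolding B_def using rGamma_bracket_pos[of "\<mu> + real m" a b] that \<mu> ab \<mu>ab by auto
  \<comment> \<open>The base is \<open>(\<mu> + a) + (\<mu> + b) + (m - 1)\<close>. It is positive
    for \<open>m >= 2\<close>; for \<open>m = 1\<close> it vanishes only if both brackets do; for
    \<open>m = 0\<close> the product is empty.\<close>
  have P_pos: "P > 0" if "\<not> (m = 1 \<and> a = -\<mu> \<and> b = -\<mu>)"
  proof (cases "m = 0")
    case False
    then show ?thesis unfolding P_def using that \<mu>ab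
      by (cases "m = 1") (auto intro!: pochhammer_pos)
  qed (simp add: P_def)
  consider (zero) "f ((m + 1) div 2) = 0"
    | (exc) "m = 0 \<and> \<mu> = -1 \<and> (a = 1 \<or> b = 1) \<or> m = 1 \<and> a = -\<mu> \<and> b = -\<mu>"
    | (pos) "f ((m + 1) div 2) \<noteq> 0" "\<not> (m = 0 \<and> \<mu> = -1 \<and> (a = 1 \<or> b = 1))"
        "\<not> (m = 1 \<and> a = -\<mu> \<and> b = -\<mu>)"
    by blast
  then show ?thesis
  proof cases
    case zero
    have "g k = 0" if "k \<le> m" for k
    proof (cases "(m + 1) div 2 \<le> k")
      case True
      then show ?thesis using no_internal_zeros_mono[OF niz zero] by (simp add: g_def)
    next
      case False
      then have "(m + 1) div 2 \<le> m - k" by linarith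
      then show ?thesis using no_internal_zeros_mono[OF niz zero] by (simp add: g_def)
    qed
    then show ?thesis using zero coeff by simp
  next
    case exc
    have "rGamma (-1 :: real) = 0" using rGamma_plus1[of "-1::real"] by simp
    then have "P * B = 0" using exc by (auto simp: P_def B_def)
    \<comment> \<open>For \<open>m <= 1\<close> the product \<open>f k * f (m - k)\<close> does not
      depend on \<open>k\<close>.\<close>
    moreover have "(\<Sum>k\<le>m. g k * D k) = f 0 * f m * (\<Sum>k\<le>m. D k)"
    proof -
      have "m = 0 \<or> m = 1" using exc by auto
      then show ?thesis by (auto simp: g_def algebra_simps)
    qed
    ultimately have "2 * fact m * phi_coeff f a b \<mu> m = 0" unfolding coeff sumD by simp
    then have "phi_coeff f a b \<mu> m = 0" by simp
    then show ?thesis using exc by auto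
  next
    case pos
    have "(\<Sum>k\<le>m. g k * D k) > 0"
    proof (rule symmetric_weighted_sum_pos)
      show "g (m - k) = g k" if "k \<le> m" for k using that by (simp add: g_def mult.commute)
      show "D (m - k) = D k" if "k \<le> m" for k
        using that binomial_symmetric[OF that] by (simp add: D_def rGamma_cross_def)
      show "g k \<ge> 0" for k using f0 by (simp add: g_def)
      show "g i \<le> g j" if "i \<le> j" "j \<le> m div 2" for i j
        unfolding g_def by (rule log_concave_mult_mono[OF lc niz that])
      have "f (m div 2) \<noteq> 0"
        using pos(1) no_internal_zeros_mono[OF niz, of "m div 2" "(m + 1) div 2"] by fastforce
      moreover have "m - m div 2 = (m + 1) div 2" by linarith
      ultimately show "g (m div 2) > 0"
        using pos(1) f0[of "m div 2"] f0[of "(m + 1) div 2"] by (simp add: g_def)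
      show "(\<Sum>k\<le>m. D k) > 0" using sumD B_pos P_pos pos by simp
      show "D (k - 1) \<le> 0" if k: "0 < k" "k \<le> m div 2" "D k \<le> 0" for k
      proof -
        obtain j where j: "k = Suc j" using k by (cases k) auto
        have "m choose k > 0" using k by (intro zero_less_binomial) linarith
        \<comment> \<open>The binomial factor is positive, so \<open>D\<close> has the sign of the
          cross term. Taking \<open>p = \<mu> + j\<close> and \<open>q = \<mu> + (m - k)\<close>
          moves the index pair \<open>(k, m - k)\<close> to \<open>(j, m - j)\<close>.\<close>
        then have "rGamma_cross a b (\<mu> + real j + 1) (\<mu> + real (m - k)) \<le> 0"
          using k(3) j by (simp add: D_def mult_le_0_iff add_ac)
        then have "rGamma_cross a b (\<mu> + real j) (\<mu> + real (m - k) + 1) \<le> 0"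
        proof (rule rGamma_cross_nonpos_step[rotated 6])
          have "j + 1 \<le> m - k" using j k by linarith
          then show "\<mu> + real j + 1 \<le> \<mu> + real (m - k)" by linarith
        qed (use ab \<mu> \<mu>ab in auto)
        moreover have "real (m - k) + 1 = real (m - j)" using j k by linarith
        ultimately show ?thesis
          using j by (simp add: D_def mult_le_0_iff add.assoc)
      qed
    qed
    then have "phi_coeff f a b \<mu> m > 0"
      using coeff by (metis fact_gt_zero mult_pos_pos zero_less_mult_pos zero_less_numeral)
    then show ?thesis using pos by auto
  qed
qed

section \<open>Convergence, continuity and positivity of the series\<close>

lemma log_concave_geometric_bound:
  assumes "log_concave_seq f" "no_internal_zeros f" "f 0 > 0"
  shows "f n \<le> f 0 * (f 1 / f 0) ^ n"
proof (induction n)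
  case (Suc n)
  have "f (Suc n) \<le> (f 1 / f 0) * f n"
    using log_concave_mult_le[OF assms(1,2), of 0 n] assms(3) by (simp add: field_simps)
  also have "\<dots> \<le> (f 1 / f 0) * (f 0 * (f 1 / f 0) ^ n)"
    using assms by (intro mult_left_mono Suc.IH) (auto simp: log_concave_seq_def)
  finally show ?case by (simp add: mult_ac)
qed simp

text \<open>A geometric bound on \<open>f\<close> and a uniform bound on \<open>rGamma\<close> give
  an exponential series free of \<open>\<mu>\<close>. It serves both absolute convergence and the
  Weierstrass test for continuity in \<open>\<mu>\<close>.\<close>

lemma rgamma_series_majorant:
  assumes "log_concave_seq f" "no_internal_zeros f" "f 0 > 0"
  obtains M where "summable M"
    "\<And>n \<mu>. \<mu> \<ge> -1 \<Longrightarrow> norm (f n * x ^ n / fact n * rGamma (\<mu> + real n)) \<le> M n"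
proof -
  obtain C :: real where C: "C > 0" "\<And>y. y \<ge> -1 \<Longrightarrow> \<bar>rGamma y\<bar> \<le> C"
    using rGamma_real_bounded by blast
  define M where "M = (\<lambda>n. C * f 0 * ((f 1 / f 0 * \<bar>x\<bar>) ^ n / fact n))"
  have "summable M"
    using summable_mult[OF summable_exp[of "f 1 / f 0 * \<bar>x\<bar>"], of "C * f 0"]
    by (simp only: M_def divide_inverse_commute)
  moreover have "norm (f n * x ^ n / fact n * rGamma (\<mu> + real n)) \<le> M n" if "\<mu> \<ge> -1" for n \<mu>
  proof -
    have "f n \<ge> 0" using assms(1) by (simp add: log_concave_seq_def)
    then have "norm (f n * x ^ n / fact n * rGamma (\<mu> + real n))
        = f n * (\<bar>x\<bar> ^ n / fact n) * \<bar>rGamma (\<mu> + real n)\<bar>"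
      by (simp add: abs_mult power_abs)
    also have "\<dots> \<le> (f 0 * (f 1 / f 0) ^ n) * (\<bar>x\<bar> ^ n / fact n) * C"
      using that C log_concave_geometric_bound[OF assms, of n] assms \<open>f n \<ge> 0\<close>
      by (intro mult_mono) auto
    also have "\<dots> = M n" unfolding M_def power_mult_distrib by simp
    finally show ?thesis .
  qed
  ultimately show ?thesis using that by blast
qed

lemma phi_coeff_sums:
  assumes "log_concave_seq f" "no_internal_zeros f" "f 0 > 0"
    and "-1 \<le> \<mu>" "0 \<le> \<mu> + a" "0 \<le> \<mu> + b" "0 < a" "0 < b"
  shows "(\<lambda>m. phi_coeff f a b \<mu> m * x ^ m) sums phi f a b \<mu> x"
proof -
  obtain M where M: "summable M"
    "\<And>n \<mu>. \<mu> \<ge> -1 \<Longrightarrow> norm (f n * x ^ n / fact n * rGamma (\<mu> + real n)) \<le> M n"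
    using rgamma_series_majorant[OF assms(1-3)] by blast
  have summ: "summable (\<lambda>n. norm (f n * x ^ n / fact n * rGamma (\<nu> + real n)))" if "\<nu> \<ge> -1" for \<nu>
    by (rule summable_comparison_test'[OF M(1)]) (use M(2)[OF that] in simp)
  have prod: "(\<lambda>m. fps_nth (rgamma_fps f \<nu> * rgamma_fps f \<kappa>) m * x ^ m)
      sums (rgamma_series f \<nu> x * rgamma_series f \<kappa> x)" if "\<nu> \<ge> -1" "\<kappa> \<ge> -1" for \<nu> \<kappa>
  proof -
    have "fps_nth (rgamma_fps f \<nu> * rgamma_fps f \<kappa>) m * x ^ m =
      (\<Sum>i\<le>m. (f i * x ^ i / fact i * rGamma (\<nu> + real i)) *
         (f (m - i) * x ^ (m - i) / fact (m - i) * rGamma (\<kappa> + real (m - i))))" for m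
      unfolding fps_mult_nth atLeast0AtMost sum_distrib_right
    proof (intro sum.cong refl)
      fix i assume "i \<in> {..m}"
      then have "x ^ m = x ^ i * x ^ (m - i)" by (simp flip: power_add)
      then show "fps_nth (rgamma_fps f \<nu>) i * fps_nth (rgamma_fps f \<kappa>) (m - i) * x ^ m =
        (f i * x ^ i / fact i * rGamma (\<nu> + real i)) *
         (f (m - i) * x ^ (m - i) / fact (m - i) * rGamma (\<kappa> + real (m - i)))"
        by (simp add: rgamma_fps_def)
    qed
    then show ?thesis
      using Cauchy_product_sums[OF summ[OF that(1)] summ[OF that(2)]]
      unfolding rgamma_series_def by simp
  qed
  show ?thesis
    using sums_diff[OF prod[of "a + \<mu>" "b + \<mu>"] prod[of "a + b + \<mu>" \<mu>]] assms
    unfolding phi_coeff_def phi_def by (simp add: algebra_simps)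
qed

lemma continuous_on_rgamma_series:
  assumes "log_concave_seq f" "no_internal_zeros f" "f 0 > 0"
  shows "continuous_on {-1..} (\<lambda>\<mu>. rgamma_series f \<mu> x)"
proof -
  obtain M where M: "summable M"
    "\<And>n \<mu>. \<mu> \<ge> -1 \<Longrightarrow> norm (f n * x ^ n / fact n * rGamma (\<mu> + real n)) \<le> M n"
    using rgamma_series_majorant[OF assms] by blast
  have "uniform_limit {-1..} (\<lambda>N \<mu>. \<Sum>n<N. f n * x ^ n / fact n * rGamma (\<mu> + real n))
      (\<lambda>\<mu>. rgamma_series f \<mu> x) sequentially"
    unfolding rgamma_series_def using M by (intro Weierstrass_m_test) auto
  moreover have "continuous_on {-1..} (\<lambda>\<mu>. \<Sum>n<N. f n * x ^ n / fact n * rGamma (\<mu> + real n))" for N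
    by (intro continuous_intros continuous_on_compose2[OF continuous_on_rGamma[of UNIV]]) auto
  ultimately show ?thesis
    by (intro uniform_limit_theorem[of _ _ sequentially]) (auto intro: always_eventually)
qed

lemma rgamma_series_pos:
  assumes "log_concave_seq f" "no_internal_zeros f" "f 0 > 0" "\<mu> > 0" "x \<ge> 0"
  shows "rgamma_series f \<mu> x > 0"
proof -
  obtain M where M: "summable M"
    "\<And>n \<mu>. \<mu> \<ge> -1 \<Longrightarrow> norm (f n * x ^ n / fact n * rGamma (\<mu> + real n)) \<le> M n"
    using rgamma_series_majorant[OF assms(1-3)] by blast
  have "summable (\<lambda>n. f n * x ^ n / fact n * rGamma (\<mu> + real n))"
    by (rule summable_comparison_test'[OF M(1)]) (use M(2) assms in simp)
  moreover have "f n * x ^ n / fact n * rGamma (\<mu> + real n) \<ge> 0" for n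
    using assms by (auto simp: log_concave_seq_def intro!: mult_nonneg_nonneg divide_nonneg_nonneg rGamma_real_nonneg)
  ultimately show ?thesis
    unfolding rgamma_series_def using assms rGamma_real_pos[of \<mu>] by (intro suminf_pos2[of _ 0]) auto
qed

section \<open>Everywhere convergent power series with nonnegative coefficients\<close>

lemma absolutely_monotonic_power_series:
  assumes sums: "\<And>x. (\<lambda>m. c m * x ^ m) sums F x" and nonneg: "\<And>m. c m \<ge> 0"
  shows "absolutely_monotonic F"
proof -
  \<comment> \<open>The induction carries the whole power series: termwise differentiation preserves
    convergence everywhere and nonnegative coefficients.\<close>
  have "\<exists>c. (\<forall>x. (\<lambda>m. c m * x ^ m) sums (deriv ^^ n) F x) \<and> (\<forall>m. 0 \<le> c m)" for n
  proof (induction n)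
    case 0
    then show ?case using assms by auto
  next
    case (Suc n)
    then obtain c where c: "\<And>x. (\<lambda>m. c m * x ^ m) sums (deriv ^^ n) F x" "\<And>m. 0 \<le> c m" by blast
    have F: "(deriv ^^ n) F = (\<lambda>x. \<Sum>m. c m * x ^ m)" using c(1) by (auto simp: sums_iff)
    have sm: "summable (\<lambda>m. c m * x ^ m)" for x using c(1) sums_summable by blast
    have "deriv ((deriv ^^ n) F) x = (\<Sum>m. diffs c m * x ^ m)" for x
      unfolding F by (intro DERIV_imp_deriv termdiffs_strong_converges_everywhere sm)
    then have "(\<lambda>m. diffs c m * x ^ m) sums (deriv ^^ Suc n) F x" for x
      using termdiff_converges_all[OF sm, of x] by (simp add: sums_iff)
    moreover have "0 \<le> diffs c m" for m using c(2) by (simp add: diffs_def)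
    ultimately show ?case by blast
  qed
  then have *: "\<exists>c. (\<forall>x. (\<lambda>m. c m * x ^ m) sums (deriv ^^ n) F x) \<and> (\<forall>m. 0 \<le> c m)" for n .
  show ?thesis unfolding absolutely_monotonic_def
  proof (intro allI impI conjI)
    fix n and x :: real assume x: "x > 0"
    obtain c where c: "\<And>x. (\<lambda>m. c m * x ^ m) sums (deriv ^^ n) F x" "\<And>m. 0 \<le> c m" using * by blast
    have F: "(deriv ^^ n) F = (\<lambda>x. \<Sum>m. c m * x ^ m)" using c(1) by (auto simp: sums_iff)
    have sm: "summable (\<lambda>m. c m * x ^ m)" for x using c(1) sums_summable by blast
    show "(deriv ^^ n) F field_differentiable at x"
      unfolding F field_differentiable_def using termdiffs_strong_converges_everywhere[OF sm] by blast
    show "0 \<le> (deriv ^^ n) F x"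
      unfolding F using x c(2) by (intro suminf_nonneg sm) auto
  qed
qed

text \<open>This is Hoelder's inequality for the terms of the two series. Young's inequality is
  applied to terms normalized by \<open>F x\<close> and \<open>F y\<close>, which is why the zero
  series is treated apart.\<close>

lemma multiplicatively_convex_power_series:
  assumes sums: "\<And>x. (\<lambda>m. c m * x ^ m) sums F x" and nonneg: "\<And>m. c m \<ge> 0"
  shows "multiplicatively_convex F"
proof (cases "\<forall>m. c m = 0")
  case True
  then have "F x = 0" for x using sums[of x] by (simp add: sums_iff)
  then show ?thesis by (simp add: multiplicatively_convex_def)
next
  case False
  then obtain i where i: "c i > 0" using nonneg by (metis order_le_less)
  have F_pos: "F x > 0" if "x > 0" for x
  proof -
    have "0 < (\<Sum>m. c m * x ^ m)"
      using that i nonneg by (intro suminf_pos2[of _ i] sums_summable[OF sums]) auto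
    then show ?thesis using sums_unique[OF sums] by simp
  qed
  show ?thesis unfolding multiplicatively_convex_def
  proof (intro allI impI ballI)
    fix x y l :: real assume x: "x > 0" and y: "y > 0" and l: "l \<in> {0..1}"
    define W where "W = F x powr l * F y powr (1 - l)"
    have W: "W > 0" using F_pos[OF x] F_pos[OF y] by (simp add: W_def)
    have "(x powr l * y powr (1 - l)) ^ m \<le> W * (l * (x ^ m / F x) + (1 - l) * (y ^ m / F y))" for m
    proof -
      have "(x ^ m / F x) powr l * (y ^ m / F y) powr (1 - l)
          \<le> l * (x ^ m / F x) + (1 - l) * (y ^ m / F y)"
        using l x y F_pos by (intro Youngs_inequality_0) auto
      moreover have "(x ^ m / F x) powr l * (y ^ m / F y) powr (1 - l)
          = (x powr l * y powr (1 - l)) ^ m / W"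
        using x y F_pos[OF x] F_pos[OF y]
        by (simp add: W_def powr_divide power_mult_distrib powr_powr mult.commute flip: powr_realpow)
      ultimately show ?thesis using W by (simp add: field_simps)
    qed
    then have "c m * (x powr l * y powr (1 - l)) ^ m
        \<le> W * l / F x * (c m * x ^ m) + W * (1 - l) / F y * (c m * y ^ m)" for m
      using mult_left_mono[OF _ nonneg[of m]] by (fastforce simp: algebra_simps)
    then have "F (x powr l * y powr (1 - l)) \<le> W * l / F x * F x + W * (1 - l) / F y * F y"
      by (intro sums_le[OF _ sums sums_add[OF sums_mult[OF sums] sums_mult[OF sums]]])
    also have "\<dots> = W" using F_pos[OF x] F_pos[OF y] by (simp add: field_simps)
    finally show "F (x powr l * y powr (1 - l)) \<le> F x powr l * F y powr (1 - l)"
      unfolding W_def .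
  qed
qed

(* Positivity of all coefficients fails in exactly the three situations in the "if" below, where
   the coefficient vanishes:
   - f ((m + 1) div 2) = 0: then f k * f (m - k) = 0 for all k <= m (only when f is finitely
     supported and m is larger than twice the last index of the support);
   - m = 0 with mu = -1 and a = 1 or b = 1: then both products in phi vanish at x = 0;
   - m = 1 with a = b = -mu: the coefficient has the factor a + b + 2 * mu. *)
theorem theorem1:
  fixes f :: "nat \<Rightarrow> real"
  assumes "log_concave_seq f" and "nontrivial_seq f" and "no_internal_zeros f"
  shows "(\<forall>x\<ge>0. strictly_log_concave_on {0<..} (\<lambda>\<mu>. rgamma_series f \<mu> x)) \<and>
    (\<forall>\<mu> a b :: real. \<mu> \<ge> -1 \<and> a > 0 \<and> b > 0 \<and> \<mu> + a \<ge> 0 \<and> \<mu> + b \<ge> 0 \<longrightarrow>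
       (\<forall>x. (\<lambda>m. phi_coeff f a b \<mu> m * x ^ m) sums phi f a b \<mu> x) \<and>
       (\<forall>m. if f ((m + 1) div 2) = 0
              \<or> (m = 0 \<and> \<mu> = -1 \<and> (a = 1 \<or> b = 1))
              \<or> (m = 1 \<and> a = -\<mu> \<and> b = -\<mu>)
            then phi_coeff f a b \<mu> m = 0
            else phi_coeff f a b \<mu> m > 0) \<and>
       absolutely_monotonic (phi f a b \<mu>) \<and>
       multiplicatively_convex (phi f a b \<mu>))"
proof -
  have "f 0 \<noteq> 0"
    using assms(2) no_internal_zeros_mono[OF assms(3), of 0] by (auto simp: nontrivial_seq_def)
  then have f0: "f 0 > 0" using assms(1) by (metis log_concave_seq_def order_le_less)
  note coeff = phi_coeff_cases[OF assms(1,3)] and sums = phi_coeff_sums[OF assms(1,3) f0]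
  have nonneg: "phi_coeff f a b \<mu> m \<ge> 0"
    if "\<mu> \<ge> -1" "a > 0" "b > 0" "\<mu> + a \<ge> 0" "\<mu> + b \<ge> 0" for \<mu> a b m
    using coeff[OF that, of m] by (auto split: if_splits)
  have "strictly_log_concave_on {0<..} (\<lambda>\<mu>. rgamma_series f \<mu> x)" if x: "x \<ge> 0" for x
    unfolding strictly_log_concave_on_def
  proof (intro conjI allI impI ballI)
    show "continuous_on {0<..} (\<lambda>\<mu>. rgamma_series f \<mu> x)"
      by (rule continuous_on_subset[OF continuous_on_rgamma_series[OF assms(1,3) f0]]) auto
    show "0 < rgamma_series f \<mu> x" if "\<mu> \<in> {0<..}" for \<mu>
      using rgamma_series_pos[OF assms(1,3) f0] that x by simp
    fix \<mu> h :: real assume h: "0 < h \<and> {\<mu>..\<mu> + 2 * h} \<subseteq> {0<..}"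
    then have \<mu>: "\<mu> > 0" by (simp add: subset_iff)
    have s: "(\<lambda>m. phi_coeff f h h \<mu> m * x ^ m) sums phi f h h \<mu> x"
      using h \<mu> by (intro sums) auto
    \<comment> \<open>With \<open>a = b = h\<close>, positivity of \<open>phi\<close> is the
      required inequality. Strictness rests on the constant term, so \<open>x = 0\<close> is
      covered.\<close>
    have "0 < (\<Sum>m. phi_coeff f h h \<mu> m * x ^ m)"
    proof (rule suminf_pos2[of _ 0])
      show "0 < phi_coeff f h h \<mu> 0 * x ^ 0" using coeff[of \<mu> h h 0] h \<mu> f0 by simp
      show "0 \<le> phi_coeff f h h \<mu> m * x ^ m" for m using nonneg[of \<mu> h h m] h \<mu> x by simp
    qed (rule sums_summable[OF s])
    then have "0 < phi f h h \<mu> x" using s by (simp add: sums_iff)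
    then show "rgamma_series f \<mu> x * rgamma_series f (\<mu> + 2 * h) x < (rgamma_series f (\<mu> + h) x)\<^sup>2"
      by (simp add: phi_def power2_eq_square algebra_simps)
  qed
  moreover have "absolutely_monotonic (phi f a b \<mu>)" "multiplicatively_convex (phi f a b \<mu>)"
    if "\<mu> \<ge> -1" "a > 0" "b > 0" "\<mu> + a \<ge> 0" "\<mu> + b \<ge> 0" for \<mu> a b
    using absolutely_monotonic_power_series[OF sums nonneg]
      multiplicatively_convex_power_series[OF sums nonneg] that by blast+
  ultimately show ?thesis
  proof (intro conjI allI impI; (elim conjE)?)
    fix \<mu> a b :: real
    assume "-1 \<le> \<mu>" "0 < a" "0 < b" "0 \<le> \<mu> + a" "0 \<le> \<mu> + b"
    note h = this
    show "(\<lambda>m. phi_coeff f a b \<mu> m * x ^ m) sums phi f a b \<mu> x" for x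
      by (rule sums) (use h in auto)
    show "if f ((m + 1) div 2) = 0 \<or> (m = 0 \<and> \<mu> = -1 \<and> (a = 1 \<or> b = 1))
        \<or> (m = 1 \<and> a = -\<mu> \<and> b = -\<mu>)
      then phi_coeff f a b \<mu> m = 0 else phi_coeff f a b \<mu> m > 0" for m
      by (rule coeff[OF h])
  qed blast+
qed

end
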